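(* Let $\mathcal{I}$ be a finite index set. Given extensions $\Theta:=\{(\lambda,\mu)\in\mathbb{R}^{\mathcal{I}}\times\mathbb{R}^q\mid C\lambda+D\mu\ge d\}$ of a 0/1-polytope $\Pi\subseteq\mathbb{R}^{\mathcal{I}}$ as well as $Q^i=\{(x,y)\in\mathbb{R}^n\times\mathbb{R}^{p_i}\mid A^ix+B^iy\ge b^i\}$ of pointed polyhedra $P^i\subseteq\mathbb{R}^n$, $i\in\mathcal{I}$. Moreover, for any $w\in\mathbb{R}^n$, consider the linear programs $$(\mathrm{A})\quad \max\Big\{w^T\sum_{i\in\mathcal{I}}x^i \ \Big|\ A^ix^i+B^iy^i-\lambda_ib^i\ge 0\ (i\in\mathcal{I}),\ C\lambda+D\mu\ge d\Big\}$$ in the variables $(\{x^i,y^i\}_{i\in\mathcal{I}},\lambda,\mu)$, $$(\mathrm{B}_i)\quad \bar w_i:=\max\{w^Tx\mid (x,y)\in Q^i\}\quad\text{for } i\in\mathcal{I},$$ and $$(\mathrm{C})\quad\max\{\bar w^T\lambda\mid(\lambda,\mu)\in\Theta\}.$$ Then $(\mathrm{A})$ is unbounded if and only if $\bar w_i=\infty$ for some $i\in\mathcal{I}$. Moreover, in case that $\bar w_i<\infty$ for all $i\in\mathcal{I}$, $(\{\bar x^i,\bar y^i\}_{i\in\mathcal{I}},\bar\lambda,\bar\mu)$ is an optimal solution of $(\mathrm{A})$ if and only if $(\bar x^i,\bar y^i)\in Q^i$, $i\in\mathcal{I}$, are optimal solutions of $(\mathrm{B}_i)$ and $(\bar\lambda,\bar\mu)\in\Theta$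 is an optimal solution of $(\mathrm{C})$.
   Context: For a polyhedron $Q\subseteq\mathbb{R}^p\times\mathbb{R}^q$, its projection onto the $x$-space is $\operatorname{Proj}_x(Q)=\{x\in\mathbb{R}^p\mid\exists y\in\mathbb{R}^q:(x,y)\in Q\}$, and $Q$ is called an extension of the polyhedron $P=\operatorname{Proj}_x(Q)$. Thus $\Pi$ is the projection of $\Theta$ onto the $\lambda$-space and $P^i$ is the projection of $Q^i$ onto the $x$-space. A 0/1-polytope in $\mathbb{R}^{\mathcal{I}}$ is the convex hull of a subset of $\{0,1\}^{\mathcal{I}}$. A polyhedron is called pointed if it contains no line. The equation $\bar w_i=\infty$ means that the linear program $(\mathrm{B}_i)$ is unbounded.
   Formalization: Optimality for (B_i) is required of (x^i,y^i)/λ_i if λ_i≠0; if λ_i=0, (x^i,y^i) must be in the recession cone of Q^i with w^T x^i=0 (the unscaled claim is false: P^1={1}, P^2={3}, w=1, Π=conv{e1,e2}). Π and all P^i are assumed nonempty. *)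

theory Defs
  imports
    "Jordan_Normal_Form.Matrix"
    "HOL-Library.Extended_Real"
begin

text \<open>
  \<open>\<real>\<^sup>k\<close> is \<open>carrier_vec k\<close>, and \<open>\<le>\<close> on vectors is the componentwise order between vectors of
  equal dimension. Dimensions are natural numbers and may be zero, and the dimensions of the
  auxiliary spaces and the numbers of inequalities may vary from one polyhedron to another,
  which rules out vectors indexed by a finite type. The finite index set is enumerated
  as \<open>{..<k}\<close>.
\<close>

subsection \<open>Polyhedra, projections and 0/1-polytopes\<close>

definition xy_polyhedron :: "real mat \<Rightarrow> real mat \<Rightarrow> real vec \<Rightarrow> (real vec \<times> real vec) set" where
  "xy_polyhedron A B b = {(x, y). x \<in> carrier_vec (dim_col A) \<and> y \<in> carrier_vec (dim_col B)
      \<and> A *\<^sub>v x + B *\<^sub>v y \<ge> b}"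

definition proj_x :: "(real vec \<times> real vec) set \<Rightarrow> real vec set" where
  "proj_x Q = {x. \<exists>y. (x, y) \<in> Q}"

definition convex_vec :: "nat \<Rightarrow> real vec set \<Rightarrow> bool" where
  "convex_vec k S \<longleftrightarrow> S \<subseteq> carrier_vec k \<and>
     (\<forall>x\<in>S. \<forall>y\<in>S. \<forall>u\<ge>0. \<forall>v\<ge>0. u + v = 1 \<longrightarrow> u \<cdot>\<^sub>v x + v \<cdot>\<^sub>v y \<in> S)"

text \<open>The type of vectors of varying dimension is no real vector space, so the
  constant \<open>convex\<close> does not apply; the hull operator itself is the generic one.\<close>

definition zero_one_polytope :: "nat \<Rightarrow> real vec set \<Rightarrow> bool" where
  "zero_one_polytope k P \<longleftrightarrow>
     (\<exists>V. V \<subseteq> {v \<in> carrier_vec k. \<forall>i<k. v $ i \<in> {0, 1}} \<and> P = convex_vec k hull V)"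

definition pointed :: "nat \<Rightarrow> real vec set \<Rightarrow> bool" where
  "pointed n P \<longleftrightarrow>
     \<not> (\<exists>x\<in>carrier_vec n. \<exists>v\<in>carrier_vec n. v \<noteq> 0\<^sub>v n \<and> (\<forall>t::real. x + t \<cdot>\<^sub>v v \<in> P))"

subsection \<open>Linear programs\<close>

text \<open>A linear program is given by its objective function \<open>f\<close> and its feasible set \<open>F\<close>. Its
  optimal solutions are the \<open>z\<close> with \<open>is_arg_max f (\<lambda>z. z \<in> F) z\<close>.\<close>

definition lp_unbounded :: "('a \<Rightarrow> real) \<Rightarrow> 'a set \<Rightarrow> bool" where
  "lp_unbounded f F \<longleftrightarrow> (\<forall>M. \<exists>z\<in>F. f z > M)"

definition lp_value :: "('a \<Rightarrow> real) \<Rightarrow> 'a set \<Rightarrow> ereal" where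
  "lp_value f F = (SUP z\<in>F. ereal (f z))"

lemma lp_value_eq_infinity_iff: "lp_value f F = \<infinity> \<longleftrightarrow> lp_unbounded f F"
proof
  assume "lp_value f F = \<infinity>"
  then have "ereal M < lp_value f F" for M by simp
  then show "lp_unbounded f F"
    by (simp add: lp_value_def lp_unbounded_def less_SUP_iff)
next
  assume u: "lp_unbounded f F"
  show "lp_value f F = \<infinity>"
  proof (rule ereal_top)
    fix M
    obtain z where "z \<in> F" "f z > M" using u by (auto simp: lp_unbounded_def)
    then show "ereal M \<le> lp_value f F"
      unfolding lp_value_def by (intro SUP_upper2[of z]) auto
  qed
qed

text \<open>In the combined program, a point of the variable space is \<open>(x, y, \<lambda>, \<mu>)\<close>, where \<open>x i\<close> and \<open>y i\<close>
  are the blocks of variables belonging to the index \<open>i < k\<close>. The values of \<open>x\<close> and \<open>y\<close> at other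
  arguments are irrelevant.\<close>

definition feasible_A ::
  "nat \<Rightarrow> (nat \<Rightarrow> real mat) \<Rightarrow> (nat \<Rightarrow> real mat) \<Rightarrow> (nat \<Rightarrow> real vec)
   \<Rightarrow> real mat \<Rightarrow> real mat \<Rightarrow> real vec
   \<Rightarrow> ((nat \<Rightarrow> real vec) \<times> (nat \<Rightarrow> real vec) \<times> real vec \<times> real vec) set" where
  "feasible_A k A B b C D d = {(x, y, l, u).
     (\<forall>i<k. x i \<in> carrier_vec (dim_col (A i)) \<and> y i \<in> carrier_vec (dim_col (B i)) \<and>
        A i *\<^sub>v x i + B i *\<^sub>v y i - l $ i \<cdot>\<^sub>v b i \<ge> 0\<^sub>v (dim_vec (b i))) \<and>
     l \<in> carrier_vec (dim_col C) \<and> u \<in> carrier_vec (dim_col D) \<and>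
     C *\<^sub>v l + D *\<^sub>v u \<ge> d}"

definition objective_A ::
  "nat \<Rightarrow> nat \<Rightarrow> real vec
   \<Rightarrow> (nat \<Rightarrow> real vec) \<times> (nat \<Rightarrow> real vec) \<times> real vec \<times> real vec \<Rightarrow> real" where
  "objective_A k n w = (\<lambda>(x, y, l, u). w \<bullet> finsum_vec TYPE(real) n x {..<k})"

definition objective_x :: "real vec \<Rightarrow> real vec \<times> real vec \<Rightarrow> real" where
  "objective_x w = (\<lambda>(x, y). w \<bullet> x)"

end

theory Submission
  imports Defs
begin

text \<open>
  Write \<open>H\<^sub>i(c)\<close> for the polyhedron \<open>A\<^sup>i x + B\<^sup>i y \<ge> c b\<^sup>i\<close>. A feasible point of the combined program
  is a point \<open>(\<lambda>, \<mu>)\<close> of \<open>\<Theta>\<close> together with one point of each block \<open>H\<^sub>i(\<lambda>\<^sub>i)\<close>, and the objective is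
  the sum of the block objectives. Hence for fixed \<open>(\<lambda>, \<mu>)\<close> the blocks can be optimized
  separately. Since \<open>\<Pi>\<close> lies in the unit cube, only \<open>0 \<le> \<lambda>\<^sub>i \<le> 1\<close> occurs.

  For \<open>c > 0\<close> the block \<open>H\<^sub>i(c)\<close> is \<open>Q\<^sup>i\<close> scaled by \<open>c\<close>, and \<open>H\<^sub>i(0)\<close> is the recession cone of \<open>Q\<^sup>i\<close>. If
  the supremum \<open>v\<^sub>i\<close> of \<open>w\<^sup>T x\<close> over \<open>Q\<^sup>i\<close> is finite, then no recession direction has positive
  objective value, so in both cases the supremum over \<open>H\<^sub>i(c)\<close> is \<open>c v\<^sub>i\<close> (\<open>scaled_bound\<close>,
  \<open>scaled_approx\<close>). Therefore the supremum over the completions of \<open>(\<lambda>, \<mu>)\<close> is \<open>\<Sum>\<^sub>i \<lambda>\<^sub>i v\<^sub>i\<close>, which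
  is the objective of the outer program over \<open>\<Theta>\<close>, and the two programs have the same supremum.
  This supremum is finite, because \<open>\<lambda>\<close> is bounded; and a feasible point attains it exactly when \<open>(\<lambda>, \<mu>)\<close>
  is optimal for the outer program and every block attains its own value \<open>\<lambda>\<^sub>i v\<^sub>i\<close>, which is the
  asserted description of the optimal solutions (\<open>scaled_optimal_iff\<close>).

  If some block program is unbounded, \<open>\<lambda>\<^sub>i\<close> may still vanish on all of \<open>\<Theta>\<close>, and then
  points of \<open>Q\<^sup>i\<close> with large objective value are of no direct help. What is needed is a recession
  direction of \<open>Q\<^sup>i\<close> with positive objective value, which can be added to any feasible point. Its existence
  (\<open>lp_unbounded_imp_improving_ray\<close>) is the one fact from the theory of linear inequalities that
  enters, and it is proved by Fourier-Motzkin elimination.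
\<close>

section \<open>Unbounded linear programs have improving rays\<close>

lemma real_separation_finite:
  fixes L U :: "real set"
  assumes "finite L" "finite U" and "\<And>l u. l \<in> L \<Longrightarrow> u \<in> U \<Longrightarrow> l \<le> u"
  shows "\<exists>z. (\<forall>l\<in>L. l \<le> z) \<and> (\<forall>u\<in>U. z \<le> u)"
proof (cases "L = {}")
  case True
  show ?thesis
  proof (cases "U = {}")
    case False
    then show ?thesis using True assms by (intro exI[of _ "Min U"]) auto
  qed (use True in auto)
next
  case False
  then show ?thesis using assms by (intro exI[of _ "Max L"]) auto
qed

text \<open>
  The system \<open>a z + c t \<ge> \<beta>\<close> in \<open>z\<close> and the parameter \<open>t\<close> is solvable for arbitrarily large \<open>t\<close>; the
  conclusion is that it has a recession direction with \<open>t\<close>-component \<open>1\<close>. Normalizing large solutions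
  and passing to a limit would not do, since the limit direction may have \<open>t\<close>-component \<open>0\<close>.
  Fourier-Motzkin elimination works because it never looks at the right-hand sides: it
  commutes with replacing \<open>\<beta>\<close> by \<open>0\<close>. Without variables \<open>z\<close> the claim is that \<open>c t \<ge> \<beta>\<close> for
  arbitrarily large \<open>t\<close> forces \<open>c \<ge> 0\<close>.
\<close>

lemma unbounded_parameter_imp_homogeneous_solution:
  fixes S :: "((nat \<Rightarrow> real) \<times> real \<times> real) set"
  assumes "finite S"
    and "\<And>M. \<exists>t\<ge>M. \<exists>z. \<forall>(a, c, \<beta>)\<in>S. \<beta> \<le> (\<Sum>i = 0..<N. a i * z i) + c * t"
  shows "\<exists>z. \<forall>(a, c, \<beta>)\<in>S. 0 \<le> (\<Sum>i = 0..<N. a i * z i) + c"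
  using assms
proof (induction N arbitrary: S)
  case 0
  have "0 \<le> c" if s: "(a, c, \<beta>) \<in> S" for a c \<beta>
  proof (rule ccontr)
    assume c: "\<not> 0 \<le> c"
    obtain t where t: "t \<ge> \<beta> / c + 1" "\<beta> \<le> c * t" using 0(2)[of "\<beta> / c + 1"] s by auto
    have "c * t \<le> c * (\<beta> / c + 1)" using c t(1) by (intro mult_left_mono_neg) auto
    also have "\<dots> = \<beta> + c" using c by (simp add: field_simps)
    finally show False using t(2) c by simp
  qed
  then show ?case by auto
next
  case (Suc N)
  define Pos where "Pos = {s \<in> S. fst s N > 0}"
  define Neg where "Neg = {s \<in> S. fst s N < 0}"
  define Zer where "Zer = {s \<in> S. fst s N = 0}"
  \<comment> \<open>the positive combination of two constraints in which the coefficients of variable \<open>N\<close> cancel\<close>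
  define comb :: "((nat \<Rightarrow> real) \<times> real \<times> real) \<times> ((nat \<Rightarrow> real) \<times> real \<times> real)
      \<Rightarrow> (nat \<Rightarrow> real) \<times> real \<times> real" where
    "comb = (\<lambda>((a, c, \<beta>), (a', c', \<beta>')).
       (\<lambda>i. a N * a' i - a' N * a i, a N * c' - a' N * c, a N * \<beta>' - a' N * \<beta>))"
  define S' where "S' = Zer \<union> comb ` (Pos \<times> Neg)"
  have comb_sum: "(\<Sum>i = 0..<K. (a N * a' i - a' N * a i) * z i) + (a N * c' - a' N * c) * t
      = a N * ((\<Sum>i = 0..<K. a' i * z i) + c' * t) - a' N * ((\<Sum>i = 0..<K. a i * z i) + c * t)"
    for a a' z :: "nat \<Rightarrow> real" and c c' t :: real and K
    by (simp add: left_diff_distrib right_diff_distrib distrib_left sum_subtractf sum_distrib_left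
        mult.assoc)
  have fin: "finite Pos" "finite Neg" "finite Zer"
    using Suc.prems(1) by (auto simp: Pos_def Neg_def Zer_def)
  then have finS': "finite S'" by (auto simp: S'_def)
  have unbS': "\<exists>t\<ge>M. \<exists>z. \<forall>(a, c, \<beta>)\<in>S'. \<beta> \<le> (\<Sum>i = 0..<N. a i * z i) + c * t" for M
  proof -
    obtain t z where t: "t \<ge> M"
      and z: "\<And>a c \<beta>. (a, c, \<beta>) \<in> S \<Longrightarrow> \<beta> \<le> (\<Sum>i = 0..<Suc N. a i * z i) + c * t"
      using Suc.prems(2)[of M] by blast
    have "\<beta> \<le> (\<Sum>i = 0..<N. a i * z i) + c * t" if "(a, c, \<beta>) \<in> S'" for a c \<beta>
      using that unfolding S'_def
    proof
      assume "(a, c, \<beta>) \<in> Zer"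
      then show ?thesis using z[of a c \<beta>] by (simp add: Zer_def)
    next
      assume "(a, c, \<beta>) \<in> comb ` (Pos \<times> Neg)"
      then obtain a1 c1 b1 a2 c2 b2 where s: "(a1, c1, b1) \<in> Pos" "(a2, c2, b2) \<in> Neg"
        and e: "(a, c, \<beta>) = comb ((a1, c1, b1), (a2, c2, b2))" by fast
      have "a1 N * b2 \<le> a1 N * ((\<Sum>i = 0..<Suc N. a2 i * z i) + c2 * t)"
        using s z[of a2 c2 b2] by (intro mult_left_mono) (auto simp: Pos_def Neg_def)
      moreover have "a2 N * ((\<Sum>i = 0..<Suc N. a1 i * z i) + c1 * t) \<le> a2 N * b1"
        using s z[of a1 c1 b1] by (intro mult_left_mono_neg) (auto simp: Pos_def Neg_def)
      ultimately have "\<beta> \<le> (\<Sum>i = 0..<Suc N. a i * z i) + c * t"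
        using e by (simp only: comb_def prod.case prod.inject comb_sum)
      moreover have "a N = 0" using e by (simp add: comb_def)
      ultimately show ?thesis by simp
    qed
    then show ?thesis using t by blast
  qed
  obtain z where z: "\<And>a c \<beta>. (a, c, \<beta>) \<in> S' \<Longrightarrow> 0 \<le> (\<Sum>i = 0..<N. a i * z i) + c"
    using Suc.IH[OF finS' unbS'] by blast
  \<comment> \<open>the value of variable \<open>N\<close> at which the homogeneous constraint is tight: a lower bound
    on that variable for constraints in \<open>Pos\<close>, an upper bound for those in \<open>Neg\<close>\<close>
  define bound where "bound = (\<lambda>(a, c, \<beta>::real). - ((\<Sum>i = 0..<N. a i * z i) + c) / a N)"
  have sep: "l \<le> u" if lu: "l \<in> bound ` Pos" "u \<in> bound ` Neg" for l u
  proof -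
    obtain a1 c1 b1 a2 c2 b2 where s: "(a1, c1, b1) \<in> Pos" "(a2, c2, b2) \<in> Neg"
      and e: "l = bound (a1, c1, b1)" "u = bound (a2, c2, b2)" using lu by fast
    have sgn: "a1 N > 0" "a2 N < 0" using s by (auto simp: Pos_def Neg_def)
    have "comb ((a1, c1, b1), (a2, c2, b2)) \<in> S'"
      unfolding S'_def using s by (intro UnI2 imageI SigmaI)
    from z[OF this[unfolded comb_def prod.case]] have "0 \<le> a1 N * ((\<Sum>i = 0..<N. a2 i * z i) + c2)
        - a2 N * ((\<Sum>i = 0..<N. a1 i * z i) + c1)"
      using comb_sum[where K = N and t = 1] by simp
    then show ?thesis using sgn by (simp add: e bound_def field_simps)
  qed
  have "\<exists>\<zeta>. (\<forall>l\<in>bound ` Pos. l \<le> \<zeta>) \<and> (\<forall>u\<in>bound ` Neg. \<zeta> \<le> u)"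
    by (rule real_separation_finite) (use fin in \<open>simp_all only: finite_imageI sep\<close>)
  then obtain \<zeta> where
    "\<forall>l\<in>bound ` Pos. l \<le> \<zeta>" "\<forall>u\<in>bound ` Neg. \<zeta> \<le> u" by (elim exE conjE)
  then have lo: "\<And>s. s \<in> Pos \<Longrightarrow> bound s \<le> \<zeta>" and up: "\<And>s. s \<in> Neg \<Longrightarrow> \<zeta> \<le> bound s"
    by (simp_all only: ball_simps)
  have "0 \<le> (\<Sum>i = 0..<Suc N. a i * (z(N := \<zeta>)) i) + c" if s: "(a, c, \<beta>) \<in> S" for a c \<beta>
  proof -
    consider "a N > 0" | "a N < 0" | "a N = 0" by linarith
    then have "0 \<le> (\<Sum>i = 0..<N. a i * z i) + a N * \<zeta> + c"
    proof cases
      case 1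
      then show ?thesis using lo[of "(a, c, \<beta>)"] s by (simp add: Pos_def bound_def field_simps)
    next
      case 2
      then show ?thesis using up[of "(a, c, \<beta>)"] s by (simp add: Neg_def bound_def field_simps)
    next
      case 3
      then show ?thesis using z[of a c \<beta>] s by (simp add: Zer_def S'_def)
    qed
    then show ?thesis by simp
  qed
  then show ?case by blast
qed

lemma mem_xy_polyhedron_iff:
  assumes "A \<in> carrier_mat m n" "B \<in> carrier_mat m p" "b \<in> carrier_vec m"
  shows "(x, y) \<in> xy_polyhedron A B b \<longleftrightarrow>
    x \<in> carrier_vec n \<and> y \<in> carrier_vec p \<and> (\<forall>j<m. b $ j \<le> row A j \<bullet> x + row B j \<bullet> y)"
  using assms by (auto simp: xy_polyhedron_def less_eq_vec_def)

text \<open>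
  Apply the preceding lemma to the constraints of the polyhedron together with \<open>w\<^sup>T x - t \<ge> 0\<close>.
  A recession direction of this system with \<open>t\<close>-component \<open>1\<close> satisfies \<open>w\<^sup>T r \<ge> 1\<close>.
\<close>

lemma lp_unbounded_imp_improving_ray:
  assumes A: "A \<in> carrier_mat m n" and B: "B \<in> carrier_mat m p" and b: "b \<in> carrier_vec m"
    and w: "w \<in> carrier_vec n"
    and unb: "lp_unbounded (objective_x w) (xy_polyhedron A B b)"
  shows "\<exists>(r, s)\<in>xy_polyhedron A B (0\<^sub>v m). w \<bullet> r > 0"
proof -
  define S :: "((nat \<Rightarrow> real) \<times> real \<times> real) set" where "S = insert (\<lambda>i. (w @\<^sub>v 0\<^sub>v p) $ i, -1, 0)
    ((\<lambda>j. (\<lambda>i. (row A j @\<^sub>v row B j) $ i, 0, b $ j)) ` {..<m})"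
  have split_sum: "(\<Sum>i = 0..<n + p. (u @\<^sub>v v) $ i * (x @\<^sub>v y) $ i) = u \<bullet> x + v \<bullet> y"
    if "u \<in> carrier_vec n" "v \<in> carrier_vec p" "x \<in> carrier_vec n" "y \<in> carrier_vec p"
    for u v x y :: "real vec"
    using scalar_prod_append[OF that] that by (simp add: scalar_prod_def)
  have rows: "row A j \<in> carrier_vec n" "row B j \<in> carrier_vec p" for j using A B by auto
  have "\<exists>t\<ge>M. \<exists>z. \<forall>(a, c, \<beta>)\<in>S. \<beta> \<le> (\<Sum>i = 0..<n + p. a i * z i) + c * t" for M
  proof -
    obtain x y where xy: "(x, y) \<in> xy_polyhedron A B b" and M: "w \<bullet> x > M"
      using unb by (force simp: lp_unbounded_def objective_x_def)
    note mem = xy[unfolded mem_xy_polyhedron_iff[OF A B b]]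
    have "\<forall>(a, c, \<beta>)\<in>S. \<beta> \<le> (\<Sum>i = 0..<n + p. a i * (x @\<^sub>v y) $ i) + c * (w \<bullet> x)"
      using mem w by (auto simp: S_def split_sum rows simp del: index_append_vec)
    then show ?thesis using M by (intro exI[of _ "w \<bullet> x"]) (auto intro!: exI[of _ "\<lambda>i. (x @\<^sub>v y) $ i"])
  qed
  moreover have "finite S" by (simp add: S_def)
  ultimately obtain z where z:
    "\<And>a c \<beta>. (a, c, \<beta>) \<in> S \<Longrightarrow> 0 \<le> (\<Sum>i = 0..<n + p. a i * z i) + c"
    using unbounded_parameter_imp_homogeneous_solution[of S "n + p"] by blast
  define r where "r = vec n z"
  define s where "s = vec p (\<lambda>i. z (n + i))"
  have rs: "r \<in> carrier_vec n" "s \<in> carrier_vec p" by (auto simp: r_def s_def)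
  have z_eq: "(\<Sum>i = 0..<n + p. a i * z i) = (\<Sum>i = 0..<n + p. a i * (r @\<^sub>v s) $ i)" for a
    by (intro sum.cong) (auto simp: r_def s_def)
  have "0 \<le> w \<bullet> r - 1"
    using z[of "\<lambda>i. (w @\<^sub>v 0\<^sub>v p) $ i" "-1" 0] w rs
    by (simp add: S_def z_eq split_sum del: index_append_vec)
  moreover have "0 \<le> row A j \<bullet> r + row B j \<bullet> s" if "j < m" for j
    using z[of "\<lambda>i. (row A j @\<^sub>v row B j) $ i" 0 "b $ j"] that rs rows
    by (simp add: S_def z_eq split_sum del: index_append_vec)
  ultimately show ?thesis
    using rs by (intro bexI[of _ "(r, s)"]) (auto simp: mem_xy_polyhedron_iff[OF A B])
qed

section \<open>Blocks with a scaled right-hand side\<close>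

lemma xy_polyhedron_scale:
  assumes "A \<in> carrier_mat m n" "B \<in> carrier_mat m p" "b \<in> carrier_vec m"
    and "c \<ge> 0" "(x, y) \<in> xy_polyhedron A B b"
  shows "(c \<cdot>\<^sub>v x, c \<cdot>\<^sub>v y) \<in> xy_polyhedron A B (c \<cdot>\<^sub>v b)"
  using assms
  by (auto simp: mem_xy_polyhedron_iff simp flip: distrib_left intro!: mult_left_mono)

lemma xy_polyhedron_add:
  assumes "A \<in> carrier_mat m n" "B \<in> carrier_mat m p" "b \<in> carrier_vec m" "b' \<in> carrier_vec m"
    and "(x, y) \<in> xy_polyhedron A B b" "(x', y') \<in> xy_polyhedron A B b'"
  shows "(x + x', y + y') \<in> xy_polyhedron A B (b + b')"
  using assms
  by (force simp: mem_xy_polyhedron_iff scalar_prod_add_distrib[of _ n] scalar_prod_add_distrib[of _ p])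

lemma xy_polyhedron_scale_iff:
  assumes "A \<in> carrier_mat m n" "B \<in> carrier_mat m p" "b \<in> carrier_vec m" "c > 0"
  shows "((1 / c) \<cdot>\<^sub>v x, (1 / c) \<cdot>\<^sub>v y) \<in> xy_polyhedron A B b \<longleftrightarrow>
    (x, y) \<in> xy_polyhedron A B (c \<cdot>\<^sub>v b)"
proof
  assume "((1 / c) \<cdot>\<^sub>v x, (1 / c) \<cdot>\<^sub>v y) \<in> xy_polyhedron A B b"
  from xy_polyhedron_scale[OF assms(1-3) _ this, of c] \<open>c > 0\<close>
  show "(x, y) \<in> xy_polyhedron A B (c \<cdot>\<^sub>v b)" by (simp add: smult_smult_assoc)
next
  assume "(x, y) \<in> xy_polyhedron A B (c \<cdot>\<^sub>v b)"
  from xy_polyhedron_scale[OF assms(1,2) _ _ this, of "1 / c"] assms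
  show "((1 / c) \<cdot>\<^sub>v x, (1 / c) \<cdot>\<^sub>v y) \<in> xy_polyhedron A B b" by (simp add: smult_smult_assoc)
qed

lemma smult_vec_zero: "(t :: real) \<cdot>\<^sub>v 0\<^sub>v m = 0\<^sub>v m"
  by auto

lemma lp_bounded_imp_ray_le_zero:
  assumes A: "A \<in> carrier_mat m n" and B: "B \<in> carrier_mat m p" and b: "b \<in> carrier_vec m"
    and w: "w \<in> carrier_vec n"
    and ne: "(x0, y0) \<in> xy_polyhedron A B b"
    and bound: "\<And>x y. (x, y) \<in> xy_polyhedron A B b \<Longrightarrow> w \<bullet> x \<le> v"
    and rs: "(r, s) \<in> xy_polyhedron A B (0\<^sub>v m)"
  shows "w \<bullet> r \<le> 0"
proof (rule ccontr)
  assume pos: "\<not> w \<bullet> r \<le> 0"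
  define t where "t = max 0 ((v - w \<bullet> x0 + 1) / (w \<bullet> r))"
  have "(t \<cdot>\<^sub>v r, t \<cdot>\<^sub>v s) \<in> xy_polyhedron A B (t \<cdot>\<^sub>v 0\<^sub>v m)"
    by (rule xy_polyhedron_scale[OF A B _ _ rs]) (auto simp: t_def)
  from xy_polyhedron_add[OF A B b _ ne this] b
  have "(x0 + t \<cdot>\<^sub>v r, y0 + t \<cdot>\<^sub>v s) \<in> xy_polyhedron A B b" by (simp add: smult_vec_zero)
  then have "w \<bullet> (x0 + t \<cdot>\<^sub>v r) \<le> v" by (rule bound)
  moreover have "x0 \<in> carrier_vec n" "r \<in> carrier_vec n"
    using ne rs b by (auto simp: mem_xy_polyhedron_iff[OF A B])
  ultimately have "w \<bullet> x0 + t * (w \<bullet> r) \<le> v" using w by (simp add: scalar_prod_add_distrib[of _ n])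
  moreover have "v - w \<bullet> x0 + 1 \<le> t * (w \<bullet> r)" using pos by (simp add: t_def pos_divide_le_eq[symmetric])
  ultimately show False by simp
qed

text \<open>
  Requiring the value to be a real number says at once that the program is feasible (otherwise
  the value is \<open>-\<infinity>\<close>) and bounded.
\<close>

locale bounded_block =
  fixes A B :: "real mat" and b w :: "real vec" and m n p :: nat and v :: real
  assumes A: "A \<in> carrier_mat m n" and B: "B \<in> carrier_mat m p" and b: "b \<in> carrier_vec m"
    and w: "w \<in> carrier_vec n"
    and lp_value_eq: "lp_value (objective_x w) (xy_polyhedron A B b) = ereal v"
begin

lemma bound: "(x, y) \<in> xy_polyhedron A B b \<Longrightarrow> w \<bullet> x \<le> v"
proof -
  assume "(x, y) \<in> xy_polyhedron A B b"
  then have "ereal (w \<bullet> x) \<le> lp_value (objective_x w) (xy_polyhedron A B b)"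
    unfolding lp_value_def by (intro SUP_upper2[of "(x, y)"]) (auto simp: objective_x_def)
  then show ?thesis by (simp add: lp_value_eq)
qed

lemma approx:
  assumes "e > 0"
  obtains x y where "(x, y) \<in> xy_polyhedron A B b" "w \<bullet> x > v - e"
proof -
  have "ereal (v - e) < lp_value (objective_x w) (xy_polyhedron A B b)"
    using assms by (simp add: lp_value_eq)
  then show ?thesis using that by (auto simp: lp_value_def less_SUP_iff objective_x_def)
qed

lemma smult_b_carrier: "c \<cdot>\<^sub>v b \<in> carrier_vec m"
  using b by simp

lemma zero_smult_b: "0 \<cdot>\<^sub>v b = 0\<^sub>v m"
  using b by auto

text \<open>
  For \<open>c > 0\<close> rescale to the original polyhedron. For \<open>c = 0\<close> the point is a recession direction,
  whose objective value cannot be positive.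
\<close>

lemma scaled_bound:
  assumes "c \<ge> 0" "(x, y) \<in> xy_polyhedron A B (c \<cdot>\<^sub>v b)"
  shows "w \<bullet> x \<le> c * v"
proof (cases "c = 0")
  case True
  obtain x0 y0 where "(x0, y0) \<in> xy_polyhedron A B b" by (rule approx[of 1]) auto
  from lp_bounded_imp_ray_le_zero[OF A B b w this bound] show ?thesis
    using assms True zero_smult_b by auto
next
  case False
  then have c: "c > 0" using assms by simp
  have x: "x \<in> carrier_vec n"
    using assms(2) mem_xy_polyhedron_iff[OF A B smult_b_carrier] by auto
  have "w \<bullet> ((1 / c) \<cdot>\<^sub>v x) \<le> v"
    using assms(2) xy_polyhedron_scale_iff[OF A B b c] bound by blast
  then show ?thesis using c w x by (simp add: field_simps)
qed

text \<open>Together with \<open>scaled_bound\<close> this says that the supremum over the scaled block is \<open>c v\<close>.\<close>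

lemma scaled_approx:
  assumes "c \<ge> 0" "e > 0"
  obtains x y where "(x, y) \<in> xy_polyhedron A B (c \<cdot>\<^sub>v b)" "w \<bullet> x \<ge> c * v - e"
proof -
  \<comment> \<open>\<open>e / (c + 1)\<close> rather than \<open>e / c\<close>, in order to cover \<open>c = 0\<close> as well\<close>
  obtain x y where xy: "(x, y) \<in> xy_polyhedron A B b" and val: "w \<bullet> x > v - e / (c + 1)"
    using approx[of "e / (c + 1)"] assms by auto
  have x: "x \<in> carrier_vec n" using xy mem_xy_polyhedron_iff[OF A B b] by auto
  have "c * v - e \<le> c * (v - e / (c + 1))" using assms by (simp add: field_simps)
  also have "\<dots> \<le> c * (w \<bullet> x)" using val assms by (intro mult_left_mono) auto
  finally show ?thesis
    using that xy_polyhedron_scale[OF A B b assms(1) xy] w x by simp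
qed

text \<open>
  The two branches on the left are one condition: the scaled block attains its value \<open>c v\<close>.
  In the degenerate case \<open>c = 0\<close>, where no point of the original polyhedron can be recovered from
  \<open>(x, y)\<close>, this means that \<open>(x, y)\<close> is a recession direction of objective value \<open>0\<close>.
\<close>

lemma scaled_optimal_iff:
  assumes "c \<ge> 0"
  shows "(if c = 0 then (x, y) \<in> xy_polyhedron A B (0\<^sub>v m) \<and> w \<bullet> x = 0
      else is_arg_max (objective_x w) (\<lambda>z. z \<in> xy_polyhedron A B b) ((1 / c) \<cdot>\<^sub>v x, (1 / c) \<cdot>\<^sub>v y))
    \<longleftrightarrow> (x, y) \<in> xy_polyhedron A B (c \<cdot>\<^sub>v b) \<and> w \<bullet> x = c * v"
proof (cases "c = 0")
  case True
  then show ?thesis using zero_smult_b by simp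
next
  case False
  then have c: "c > 0" using assms by simp
  have opt: "is_arg_max (objective_x w) (\<lambda>z. z \<in> xy_polyhedron A B b) (x', y')
      \<longleftrightarrow> (x', y') \<in> xy_polyhedron A B b \<and> w \<bullet> x' = v" for x' y'
  proof
    assume o: "is_arg_max (objective_x w) (\<lambda>z. z \<in> xy_polyhedron A B b) (x', y')"
    then have mem: "(x', y') \<in> xy_polyhedron A B b" by (simp add: is_arg_max_def)
    have "v \<le> w \<bullet> x'"
    proof (rule field_le_epsilon)
      fix e :: real assume "e > 0"
      then obtain x'' y'' where "(x'', y'') \<in> xy_polyhedron A B b" "w \<bullet> x'' > v - e"
        by (rule approx)
      then show "v \<le> w \<bullet> x' + e" using o by (force simp: is_arg_max_def objective_x_def)
    qed
    then show "(x', y') \<in> xy_polyhedron A B b \<and> w \<bullet> x' = v" using mem bound[OF mem] by simp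
  next
    assume "(x', y') \<in> xy_polyhedron A B b \<and> w \<bullet> x' = v"
    then show "is_arg_max (objective_x w) (\<lambda>z. z \<in> xy_polyhedron A B b) (x', y')"
      using bound by (force simp: is_arg_max_def objective_x_def)
  qed
  show ?thesis
  proof (cases "(x, y) \<in> xy_polyhedron A B (c \<cdot>\<^sub>v b)")
    case True
    then have "x \<in> carrier_vec n" using mem_xy_polyhedron_iff[OF A B smult_b_carrier] by auto
    then show ?thesis
      using c w True xy_polyhedron_scale_iff[OF A B b c, of x y] by (simp add: opt field_simps)
  next
    case False
    then show ?thesis using c xy_polyhedron_scale_iff[OF A B b c, of x y] by (simp add: opt)
  qed
qed

end

section \<open>The combined program\<close>

lemma zero_one_polytope_coord:
  assumes "zero_one_polytope k P" "l \<in> P" "i < k"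
  shows "0 \<le> l $ i" "l $ i \<le> 1"
proof -
  define Box where "Box = {v \<in> carrier_vec k. \<forall>i<k. 0 \<le> v $ i \<and> v $ i \<le> (1::real)}"
  obtain V where V: "V \<subseteq> {v \<in> carrier_vec k. \<forall>i<k. v $ i \<in> {0, 1}}" "P = convex_vec k hull V"
    using assms(1) by (auto simp: zero_one_polytope_def)
  have "convex_vec k Box"
    by (auto simp: convex_vec_def Box_def intro!: convex_bound_le)
  moreover have "V \<subseteq> Box" using V(1) by (force simp: Box_def)
  ultimately have "P \<subseteq> Box" unfolding V(2) by (intro hull_minimal)
  then show "0 \<le> l $ i" "l $ i \<le> 1" using assms by (auto simp: Box_def)
qed

lemma scalar_prod_finsum_vec:
  assumes "finite I" "w \<in> carrier_vec n" "\<And>i. i \<in> I \<Longrightarrow> x i \<in> carrier_vec n"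
  shows "w \<bullet> finsum_vec TYPE('a :: comm_semiring_0) n x I = (\<Sum>i\<in>I. w \<bullet> x i)"
proof -
  have "x \<in> I \<rightarrow> carrier_vec n" using assms by auto
  then have "w \<bullet> finsum_vec TYPE('a) n x I = (\<Sum>j = 0..<n. w $ j * (\<Sum>i\<in>I. x i $ j))"
    using assms(1) by (simp add: scalar_prod_def finsum_vec_closed[THEN carrier_vecD] index_finsum_vec)
  also have "\<dots> = (\<Sum>i\<in>I. \<Sum>j = 0..<n. w $ j * x i $ j)"
    unfolding sum_distrib_left by (rule sum.swap)
  also have "\<dots> = (\<Sum>i\<in>I. w \<bullet> x i)"
    using assms(3)[THEN carrier_vecD] by (intro sum.cong) (auto simp: scalar_prod_def)
  finally show ?thesis .
qed

lemma feasible_A_iff: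
  assumes "C \<in> carrier_mat r k" "D \<in> carrier_mat r q"
    and "\<And>i. i < k \<Longrightarrow> A i \<in> carrier_mat (m i) n" "\<And>i. i < k \<Longrightarrow> B i \<in> carrier_mat (m i) (p i)"
    and "\<And>i. i < k \<Longrightarrow> b i \<in> carrier_vec (m i)"
  shows "(x, y, l, u) \<in> feasible_A k A B b C D d \<longleftrightarrow>
    (l, u) \<in> xy_polyhedron C D d \<and> (\<forall>i<k. (x i, y i) \<in> xy_polyhedron (A i) (B i) (l $ i \<cdot>\<^sub>v b i))"
proof -
  have "(x i \<in> carrier_vec (dim_col (A i)) \<and> y i \<in> carrier_vec (dim_col (B i)) \<and>
      A i *\<^sub>v x i + B i *\<^sub>v y i - l $ i \<cdot>\<^sub>v b i \<ge> 0\<^sub>v (dim_vec (b i)))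
    \<longleftrightarrow> (x i, y i) \<in> xy_polyhedron (A i) (B i) (l $ i \<cdot>\<^sub>v b i)" if "i < k" for i
    using assms(3-5)[OF that] by (auto simp: xy_polyhedron_def less_eq_vec_def)
  then show ?thesis by (auto simp: feasible_A_def xy_polyhedron_def)
qed


theorem theorem1p3:
  fixes k n q r :: nat
    and p m :: "nat \<Rightarrow> nat"
    and A B :: "nat \<Rightarrow> real mat" and b :: "nat \<Rightarrow> real vec"
    and C D :: "real mat" and d :: "real vec"
    and TH :: "(real vec \<times> real vec) set" and PI :: "real vec set"
    and Q :: "nat \<Rightarrow> (real vec \<times> real vec) set" and P :: "nat \<Rightarrow> real vec set"
    and w wbar :: "real vec" and wval :: "nat \<Rightarrow> ereal"
  assumes "C \<in> carrier_mat r k" and "D \<in> carrier_mat r q" and "d \<in> carrier_vec r"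
    and "TH = xy_polyhedron C D d"
    and "PI = proj_x TH"
    and "zero_one_polytope k PI"
    and "PI \<noteq> {}"
    and "\<And>i. i < k \<Longrightarrow> A i \<in> carrier_mat (m i) n"
    and "\<And>i. i < k \<Longrightarrow> B i \<in> carrier_mat (m i) (p i)"
    and "\<And>i. i < k \<Longrightarrow> b i \<in> carrier_vec (m i)"
    and "\<And>i. i < k \<Longrightarrow> Q i = xy_polyhedron (A i) (B i) (b i)"
    and "\<And>i. i < k \<Longrightarrow> P i = proj_x (Q i)"
    and "\<And>i. i < k \<Longrightarrow> pointed n (P i)"
    and "\<And>i. i < k \<Longrightarrow> P i \<noteq> {}"
    and "w \<in> carrier_vec n"
    and "\<And>i. i < k \<Longrightarrow> wval i = lp_value (objective_x w) (Q i)"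
    and "wbar = vec k (\<lambda>i. real_of_ereal (wval i))"
  shows "(lp_unbounded (objective_A k n w) (feasible_A k A B b C D d)
            \<longleftrightarrow> (\<exists>i<k. wval i = \<infinity>)) \<and>
         ((\<forall>i<k. wval i < \<infinity>) \<longrightarrow>
           (\<forall>x y l u.
              is_arg_max (objective_A k n w) (\<lambda>z. z \<in> feasible_A k A B b C D d) (x, y, l, u)
              \<longleftrightarrow>
              (\<forall>i<k.
                 if l $ i = 0
                 then (x i, y i) \<in> xy_polyhedron (A i) (B i) (0\<^sub>v (m i)) \<and> w \<bullet> x i = 0
                 else is_arg_max (objective_x w) (\<lambda>z. z \<in> Q i)
                        ((1 / l $ i) \<cdot>\<^sub>v x i, (1 / l $ i) \<cdot>\<^sub>v y i)) \<and>
              is_arg_max (objective_x wbar) (\<lambda>z. z \<in> TH) (l, u)))"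
proof (rule conjI)
  note C = assms(1) and D = assms(2) and A = assms(8) and B = assms(9) and b = assms(10)
    and Q = assms(11) and w = assms(15) and wval = assms(16)
  define v where "v i = real_of_ereal (wval i)" for i
  let ?F = "feasible_A k A B b C D d"
  let ?f = "objective_A k n w"
  have feas: "(x, y, l, u) \<in> ?F \<longleftrightarrow>
      (l, u) \<in> TH \<and> (\<forall>i<k. (x i, y i) \<in> xy_polyhedron (A i) (B i) (l $ i \<cdot>\<^sub>v b i))" for x y l u
    unfolding assms(4) by (rule feasible_A_iff[OF C D]) (use A B b in auto)
  have l01: "0 \<le> l $ i" "l $ i \<le> 1" if "(l, u) \<in> TH" "i < k" for l u i
  proof -
    have "l \<in> PI" using that assms(5) by (auto simp: proj_x_def)
    then show "0 \<le> l $ i" "l $ i \<le> 1" using zero_one_polytope_coord[OF assms(6)] that by auto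
  qed
  have block_carrier: "x i \<in> carrier_vec n" if "(x, y, l, u) \<in> ?F" "i < k" for x y l u i
    using that feas mem_xy_polyhedron_iff[OF A B, OF that(2) that(2), of "l $ i \<cdot>\<^sub>v b i"] b by auto
  have obj: "?f (x, y, l, u) = (\<Sum>i<k. w \<bullet> x i)" if "(x, y, l, u) \<in> ?F" for x y l u
    unfolding objective_A_def prod.case
    by (rule scalar_prod_finsum_vec) (use block_carrier[OF that] w in auto)
  have "\<forall>i. \<exists>xy. i < k \<longrightarrow> xy \<in> Q i" using assms(12,14) by (fastforce simp: proj_x_def)
  then obtain q where q: "\<And>i. i < k \<Longrightarrow> q i \<in> Q i" by metis
  have block: "bounded_block (A i) (B i) (b i) w (m i) n (p i) (v i)"
    if "i < k" "wval i < \<infinity>" for i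
  proof
    have "ereal (objective_x w (q i)) \<le> wval i"
      using q[OF that(1)] wval[OF that(1)] by (auto simp: lp_value_def intro: SUP_upper)
    then have "\<bar>wval i\<bar> \<noteq> \<infinity>" using that(2) by auto
    then show "lp_value (objective_x w) (xy_polyhedron (A i) (B i) (b i))
        = ereal (v i)"
      using wval[OF that(1)] Q[OF that(1)] by (simp add: v_def ereal_real)
  qed (use that A B b w in auto)
  have wbar: "objective_x wbar (l, u) = (\<Sum>i<k. l $ i * v i)"
    if "(l, u) \<in> TH" for l u
    using that C assms(4,17)
    by (auto simp: v_def xy_polyhedron_def objective_x_def scalar_prod_def mult.commute atLeast0LessThan)
  have wx_le: "w \<bullet> x i \<le> l $ i * v i"
    if "(x, y, l, u) \<in> ?F" "i < k" "wval i < \<infinity>" for x y l u i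
    using that feas l01 bounded_block.scaled_bound[OF block] by blast

  show "lp_unbounded ?f ?F \<longleftrightarrow> (\<exists>i<k. wval i = \<infinity>)"
  proof
    assume unb: "lp_unbounded ?f ?F"
    show "\<exists>i<k. wval i = \<infinity>"
    proof (rule ccontr)
      assume fin: "\<not> (\<exists>i<k. wval i = \<infinity>)"
      obtain x y l u where z: "(x, y, l, u) \<in> ?F"
        "?f (x, y, l, u) > (\<Sum>i<k. \<bar>v i\<bar>)"
        using unb unfolding lp_unbounded_def by (metis prod_cases4)
      have "w \<bullet> x i \<le> \<bar>v i\<bar>" if i: "i < k" for i
      proof -
        have "w \<bullet> x i \<le> l $ i * v i" using wx_le[OF z(1) i] fin i by auto
        also have "\<dots> \<le> l $ i * \<bar>v i\<bar>"
          using l01 i z(1) feas by (intro mult_left_mono) auto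
        also have "\<dots> \<le> \<bar>v i\<bar>"
          using l01 i z(1) feas by (intro mult_left_le_one_le) auto
        finally show ?thesis .
      qed
      then have "(\<Sum>i<k. w \<bullet> x i) \<le> (\<Sum>i<k. \<bar>v i\<bar>)" by (intro sum_mono) auto
      then show False using z obj by simp
    qed
  next
    assume "\<exists>i<k. wval i = \<infinity>"
    then obtain j where j: "j < k" "wval j = \<infinity>" by auto
    then have "lp_unbounded (objective_x w) (xy_polyhedron (A j) (B j) (b j))"
      using wval Q lp_value_eq_infinity_iff by metis
    then obtain r s where rs: "(r, s) \<in> xy_polyhedron (A j) (B j) (0\<^sub>v (m j))" and pos: "w \<bullet> r > 0"
      using lp_unbounded_imp_improving_ray[OF A[OF j(1)] B[OF j(1)] b[OF j(1)] w] by blast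
    have r: "r \<in> carrier_vec n" using rs mem_xy_polyhedron_iff[OF A B, OF j(1) j(1)] by auto
    obtain l u where lu: "(l, u) \<in> TH" using assms(5,7) by (auto simp: proj_x_def)
    \<comment> \<open>scaled points of \<open>Q i\<close> complete \<open>(l, u)\<close> to a feasible point, also where \<open>l $ i = 0\<close>\<close>
    define x0 where "x0 = (\<lambda>i. l $ i \<cdot>\<^sub>v fst (q i))"
    define y0 where "y0 = (\<lambda>i. l $ i \<cdot>\<^sub>v snd (q i))"
    have base: "(x0 i, y0 i) \<in> xy_polyhedron (A i) (B i) (l $ i \<cdot>\<^sub>v b i)" if "i < k" for i
      unfolding x0_def y0_def using that q Q l01[OF lu]
      by (intro xy_polyhedron_scale[OF A B b]) auto
    then have base_feas: "(x0, y0, l, u) \<in> ?F" using feas lu by blast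
    show "lp_unbounded ?f ?F"
      unfolding lp_unbounded_def
    proof
      fix M
      define t where "t = max 0 ((M - ?f (x0, y0, l, u) + 1) / (w \<bullet> r))"
      define x where "x = x0(j := x0 j + t \<cdot>\<^sub>v r)"
      define y where "y = y0(j := y0 j + t \<cdot>\<^sub>v s)"
      have "(t \<cdot>\<^sub>v r, t \<cdot>\<^sub>v s) \<in> xy_polyhedron (A j) (B j) (t \<cdot>\<^sub>v 0\<^sub>v (m j))"
        by (rule xy_polyhedron_scale[OF A B _ _ rs]) (use j in \<open>auto simp: t_def\<close>)
      from xy_polyhedron_add[OF A B _ _ base this] j b[OF j(1)]
      have "(x j, y j) \<in> xy_polyhedron (A j) (B j) (l $ j \<cdot>\<^sub>v b j)" by (simp add: x_def y_def smult_vec_zero)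
      then have z: "(x, y, l, u) \<in> ?F" using base feas lu by (simp add: x_def y_def)
      have "w \<bullet> x i = w \<bullet> x0 i + (if i = j then t * (w \<bullet> r) else 0)" if "i < k" for i
        using w r block_carrier[OF base_feas that] by (auto simp: x_def scalar_prod_add_distrib[of _ n])
      then have "?f (x, y, l, u) = ?f (x0, y0, l, u) + t * (w \<bullet> r)"
        using j by (simp add: obj[OF z] obj[OF base_feas] sum.distrib)
      moreover have "M - ?f (x0, y0, l, u) + 1 \<le> t * (w \<bullet> r)"
        using pos by (simp add: t_def pos_divide_le_eq[symmetric])
      ultimately have "?f (x, y, l, u) > M" by simp
      then show "\<exists>z\<in>?F. ?f z > M" using z by blast
    qed
  qed

  show "(\<forall>i<k. wval i < \<infinity>) \<longrightarrow>
     (\<forall>x y l u. is_arg_max ?f (\<lambda>z. z \<in> ?F) (x, y, l, u) \<longleftrightarrow>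
        (\<forall>i<k. if l $ i = 0
           then (x i, y i) \<in> xy_polyhedron (A i) (B i) (0\<^sub>v (m i)) \<and> w \<bullet> x i = 0
           else is_arg_max (objective_x w) (\<lambda>z. z \<in> Q i)
                  ((1 / l $ i) \<cdot>\<^sub>v x i, (1 / l $ i) \<cdot>\<^sub>v y i)) \<and>
        is_arg_max (objective_x wbar) (\<lambda>z. z \<in> TH) (l, u))"
    (is "_ \<longrightarrow> (\<forall>x y l u. ?opt x y l u \<longleftrightarrow> (\<forall>i<k. ?blk x y l i) \<and> ?optC l u)")
  proof (intro impI allI)
    fix x y l u
    assume fin: "\<forall>i<k. wval i < \<infinity>"
    have blk: "?blk x y l i \<longleftrightarrow> (x i, y i) \<in> xy_polyhedron (A i) (B i) (l $ i \<cdot>\<^sub>v b i)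
        \<and> w \<bullet> x i = l $ i * v i" if "(l, u) \<in> TH" "i < k" for i
      unfolding Q[OF that(2)]
      by (rule bounded_block.scaled_optimal_iff[OF block l01(1)]) (use that fin in auto)
    have le_wbar: "?f (x', y', l', u') \<le> objective_x wbar (l', u')"
      if "(x', y', l', u') \<in> ?F" for x' y' l' u'
    proof -
      have "(l', u') \<in> TH" using that feas by blast
      then show ?thesis using that fin by (auto simp: obj wbar intro!: sum_mono wx_le)
    qed
    show "?opt x y l u \<longleftrightarrow> (\<forall>i<k. ?blk x y l i) \<and> ?optC l u"
    proof
      assume opt: "?opt x y l u"
      then have z: "(x, y, l, u) \<in> ?F" by (simp add: is_arg_max_def)
      then have lu: "(l, u) \<in> TH" using feas by blast
      \<comment> \<open>nearly optimal blocks complete any point of \<open>TH\<close> to a feasible point, which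
        cannot beat the optimal one\<close>
      have sup: "objective_x wbar (l', u') \<le> ?f (x, y, l, u)" if lu': "(l', u') \<in> TH" for l' u'
      proof (rule field_le_epsilon)
        fix e :: real assume "e > 0"
        \<comment> \<open>the error is spread over the \<open>k\<close> blocks; \<open>+ 1\<close> covers \<open>k = 0\<close>\<close>
        define \<delta> where "\<delta> = e / (real k + 1)"
        have \<delta>: "\<delta> > 0" "real k * \<delta> \<le> e" using \<open>e > 0\<close> by (auto simp: \<delta>_def field_simps)
        have "\<exists>xi yi. (xi, yi) \<in> xy_polyhedron (A i) (B i) (l' $ i \<cdot>\<^sub>v b i) \<and>
            w \<bullet> xi \<ge> l' $ i * v i - \<delta>" if i: "i < k" for i
          using bounded_block.scaled_approx[OF block[OF i] l01(1)[OF lu' i] \<delta>(1)] fin i by metis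
        then obtain x' y' where xy':
          "\<And>i. i < k \<Longrightarrow> (x' i, y' i) \<in> xy_polyhedron (A i) (B i) (l' $ i \<cdot>\<^sub>v b i)"
          "\<And>i. i < k \<Longrightarrow> l' $ i * v i - \<delta> \<le> w \<bullet> x' i"
          by metis
        have z': "(x', y', l', u') \<in> ?F" using feas lu' xy'(1) by blast
        have "objective_x wbar (l', u') - real k * \<delta>
            = (\<Sum>i<k. l' $ i * v i - \<delta>)"
          by (simp add: wbar[OF lu'] sum_subtractf)
        also have "\<dots> \<le> (\<Sum>i<k. w \<bullet> x' i)" using xy'(2) by (intro sum_mono) auto
        also have "\<dots> = ?f (x', y', l', u')" using obj[OF z'] by simp
        also have "\<dots> \<le> ?f (x, y, l, u)" using opt z' by (force simp: is_arg_max_def)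
        finally show "objective_x wbar (l', u') \<le> ?f (x, y, l, u) + e" using \<delta>(2) by simp
      qed
      \<comment> \<open>each block is at most its bound and the sums agree, so every block meets its bound\<close>
      have "(\<Sum>i<k. w \<bullet> x i) = (\<Sum>i<k. l $ i * v i)"
        using sup[OF lu] le_wbar[OF z] by (simp add: wbar[OF lu] obj[OF z])
      then have "w \<bullet> x i = l $ i * v i" if "i < k" for i
        by (rule sum_mono_inv) (use that fin wx_le[OF z] in auto)
      then have "\<forall>i<k. ?blk x y l i" using blk[OF lu] z feas by blast
      moreover have "?optC l u"
        unfolding is_arg_max_def using lu sup le_wbar[OF z] by (fastforce simp: not_less)
      ultimately show "(\<forall>i<k. ?blk x y l i) \<and> ?optC l u" by blast
    next
      assume R: "(\<forall>i<k. ?blk x y l i) \<and> ?optC l u"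
      then have lu: "(l, u) \<in> TH" by (simp add: is_arg_max_def)
      have z: "(x, y, l, u) \<in> ?F" using R blk[OF lu] feas lu by blast
      have "?f (x, y, l, u) = objective_x wbar (l, u)"
        using R blk[OF lu] by (simp add: obj[OF z] wbar[OF lu])
      moreover have "?f (x', y', l', u') \<le> objective_x wbar (l, u)"
        if "(x', y', l', u') \<in> ?F" for x' y' l' u'
        using le_wbar[OF that] R that feas by (force simp: is_arg_max_def not_less)
      ultimately show "?opt x y l u"
        using z by (fastforce simp: is_arg_max_def not_less)
    qed
  qed
qed

end
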